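(* Let $I$ be an ideal of a reduced commutative ring $R$ such that $R/I$ is a flat $R$-module. Then $I=\sqrt{I}$.
   Context: All rings are commutative with identity. $\sqrt{I}$ denotes the radical of the ideal $I$. *)

theory Defs
  imports "HOL-Algebra.Algebra"
begin

definition reduced_ring :: "('r, 'k) ring_scheme \<Rightarrow> bool" where
  "reduced_ring R \<longleftrightarrow>
     (\<forall>x \<in> carrier R. \<forall>n::nat. x [^]\<^bsub>R\<^esub> n = \<zero>\<^bsub>R\<^esub> \<longrightarrow> x = \<zero>\<^bsub>R\<^esub>)"

definition ideal_radical :: "('r, 'k) ring_scheme \<Rightarrow> 'r set \<Rightarrow> 'r set" where
  "ideal_radical R I = {x \<in> carrier R. \<exists>n::nat. n \<ge> 1 \<and> x [^]\<^bsub>R\<^esub> n \<in> I}"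

definition quotient_module :: "('r, 'k) ring_scheme \<Rightarrow> 'r set \<Rightarrow> ('r, 'r set) module" where
  "quotient_module R I =
     \<lparr>carrier = carrier (R Quot I), monoid.mult = monoid.mult (R Quot I), monoid.one = monoid.one (R Quot I),
      ring.zero = ring.zero (R Quot I), ring.add = ring.add (R Quot I),
      smult = (\<lambda>r C. (I +>\<^bsub>R\<^esub> r) \<otimes>\<^bsub>R Quot I\<^esub> C)\<rparr>"

definition module_hom ::
    "('r, 'k) ring_scheme \<Rightarrow> ('r, 'm, 'u) module_scheme \<Rightarrow> ('r, 'n, 'v) module_scheme \<Rightarrow> ('m \<Rightarrow> 'n) set"
  where
  "module_hom R M N = {f \<in> carrier M \<rightarrow> carrier N.
     (\<forall>x \<in> carrier M. \<forall>y \<in> carrier M. f (x \<oplus>\<^bsub>M\<^esub> y) = f x \<oplus>\<^bsub>N\<^esub> f y) \<and>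
     (\<forall>r \<in> carrier R. \<forall>x \<in> carrier M. f (r \<odot>\<^bsub>M\<^esub> x) = r \<odot>\<^bsub>N\<^esub> f x)}"

text \<open>
  The tensor product over \<open>R\<close> is the free abelian group on \<open>M \<times> N\<close> modulo the relations making
  \<open>(x, y) \<mapsto> x \<otimes> y\<close> biadditive and \<open>R\<close>-balanced. Only its additive group (written
  multiplicatively, as a \<^typ>\<open>'a monoid\<close>) is constructed: the scalar action plays no role
  in whether an induced map is injective.
\<close>

definition tensor_relators ::
    "('r, 'k) ring_scheme \<Rightarrow> ('r, 'm, 'u) module_scheme \<Rightarrow> ('r, 'n, 'v) module_scheme \<Rightarrow> ('m \<times> 'n \<Rightarrow>\<^sub>0 int) set"
  where
  "tensor_relators R M N =
     {frag_of (x \<oplus>\<^bsub>M\<^esub> x', y) - frag_of (x, y) - frag_of (x', y) | x x' y.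
        x \<in> carrier M \<and> x' \<in> carrier M \<and> y \<in> carrier N} \<union>
     {frag_of (x, y \<oplus>\<^bsub>N\<^esub> y') - frag_of (x, y) - frag_of (x, y') | x y y'.
        x \<in> carrier M \<and> y \<in> carrier N \<and> y' \<in> carrier N} \<union>
     {frag_of (r \<odot>\<^bsub>M\<^esub> x, y) - frag_of (x, r \<odot>\<^bsub>N\<^esub> y) | r x y.
        r \<in> carrier R \<and> x \<in> carrier M \<and> y \<in> carrier N}"

definition tensor_kernel ::
    "('r, 'k) ring_scheme \<Rightarrow> ('r, 'm, 'u) module_scheme \<Rightarrow> ('r, 'n, 'v) module_scheme \<Rightarrow> ('m \<times> 'n \<Rightarrow>\<^sub>0 int) set"
  where
  "tensor_kernel R M N =
     generate (free_Abelian_group (carrier M \<times> carrier N)) (tensor_relators R M N)"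

definition tensor_product ::
    "('r, 'k) ring_scheme \<Rightarrow> ('r, 'm, 'u) module_scheme \<Rightarrow> ('r, 'n, 'v) module_scheme
      \<Rightarrow> ('m \<times> 'n \<Rightarrow>\<^sub>0 int) set monoid"
  where
  "tensor_product R M N =
     free_Abelian_group (carrier M \<times> carrier N) Mod tensor_kernel R M N"

text \<open>
  The map \<open>f \<otimes> id\<close> from \<open>N \<otimes> M\<close> to \<open>N' \<otimes> M\<close> for \<open>f\<close> from \<open>N\<close> to \<open>N'\<close>. All elements of a
  coset in \<open>N \<otimes> M\<close> are sent into the same coset in \<open>N' \<otimes> M\<close>; see
  \<open>tensor_map_rcoset\<close> below.
\<close>

definition tensor_map ::
    "('r, 'k) ring_scheme \<Rightarrow> ('r, 'n', 'v) module_scheme \<Rightarrow> ('r, 'm, 'u) module_scheme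
      \<Rightarrow> ('n \<Rightarrow> 'n') \<Rightarrow> ('n \<times> 'm \<Rightarrow>\<^sub>0 int) set \<Rightarrow> ('n' \<times> 'm \<Rightarrow>\<^sub>0 int) set"
  where
  "tensor_map R N' M f C =
     the_elem ((\<lambda>c. tensor_kernel R N' M
         #>\<^bsub>free_Abelian_group (carrier N' \<times> carrier M)\<^esub>
       frag_extend (\<lambda>(x, y). frag_of (f x, y)) c) ` C)"

text \<open>
  \<open>M\<close> is flat if \<open>- \<otimes> M\<close> preserves injectivity of linear maps between \<open>R\<close>-modules. As HOL
  cannot quantify over types inside a formula, the type \<open>'n\<close> carrying the test modules
  is a parameter. Flatness in the usual sense implies \<open>flat_module TYPE('n) R M\<close>
  for every \<open>'n\<close>. Conversely, if \<open>'n\<close> is the type of elements of \<open>R\<close>, then the test modules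
  include \<open>R\<close> and all its ideals, which suffices for flatness in the usual sense by the ideal
  criterion.
\<close>

definition flat_module ::
    "'n itself \<Rightarrow> ('r, 'k) ring_scheme \<Rightarrow> ('r, 'm, 'u) module_scheme \<Rightarrow> bool"
  where
  "flat_module (_ :: 'n itself) R M \<longleftrightarrow> module R M \<and>
     (\<forall>(N :: ('r, 'n) module) (N' :: ('r, 'n) module) f.
        module R N \<and> module R N' \<and> f \<in> module_hom R N N' \<and> inj_on f (carrier N) \<longrightarrow>
        inj_on (tensor_map R N' M f) (carrier (tensor_product R N M)))"

lemma quotient_module_simps [simp]:
  "carrier (quotient_module R I) = a_rcosets\<^bsub>R\<^esub> I"
  "C \<oplus>\<^bsub>quotient_module R I\<^esub> Y = C <+>\<^bsub>R\<^esub> Y"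
  "\<zero>\<^bsub>quotient_module R I\<^esub> = I"
  "r \<odot>\<^bsub>quotient_module R I\<^esub> C = (I +>\<^bsub>R\<^esub> r) \<otimes>\<^bsub>R Quot I\<^esub> C"
  by (simp_all add: quotient_module_def FactRing_def)

lemma module_quotient_module:
  assumes "cring R" "ideal I R"
  shows "module R (quotient_module R I)"
proof -
  interpret cring R by fact
  interpret I: ideal I R by fact
  interpret Q: ring "R Quot I" by (rule I.quotient_is_ring)
  have car: "carrier (R Quot I) = a_rcosets\<^bsub>R\<^esub> I" by (simp add: FactRing_def)
  have add: "C \<oplus>\<^bsub>R Quot I\<^esub> Y = C <+>\<^bsub>R\<^esub> Y" for C Y by (simp add: FactRing_def)
  have zero: "\<zero>\<^bsub>R Quot I\<^esub> = I" by (simp add: FactRing_def)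
  have cl: "I +>\<^bsub>R\<^esub> r \<in> a_rcosets\<^bsub>R\<^esub> I" if "r \<in> carrier R" for r
    using that by (simp add: a_rcosetsI I.a_subset)
  have h: "a_r_coset R I \<in> ring_hom R (R Quot I)" by (rule I.rcos_ring_hom)
  have hadd: "I +>\<^bsub>R\<^esub> (a \<oplus>\<^bsub>R\<^esub> b) = (I +>\<^bsub>R\<^esub> a) <+>\<^bsub>R\<^esub> (I +>\<^bsub>R\<^esub> b)" if "a \<in> carrier R" "b \<in> carrier R" for a b
    using ring_hom_add[OF h that] by (simp add: add)
  note hmult = ring_hom_mult[OF h]
  note hone = ring_hom_one[OF h]
  note Qadd = Q.a_closed[unfolded car add] Q.a_assoc[unfolded car add] Q.l_zero[unfolded car add zero]
  show ?thesis
  proof (rule moduleI)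
    show "abelian_group (quotient_module R I)"
    proof (rule abelian_groupI)
      fix x assume "x \<in> carrier (quotient_module R I)"
      then show "\<exists>y\<in>carrier (quotient_module R I). y \<oplus>\<^bsub>quotient_module R I\<^esub> x = \<zero>\<^bsub>quotient_module R I\<^esub>"
        using Q.l_neg[unfolded car add zero] Q.a_inv_closed[unfolded car] by auto
    next
      show "\<zero>\<^bsub>quotient_module R I\<^esub> \<in> carrier (quotient_module R I)"
        using Q.zero_closed[unfolded car zero] by simp
    next
      fix x y assume "x \<in> carrier (quotient_module R I)" "y \<in> carrier (quotient_module R I)"
      then show "x \<oplus>\<^bsub>quotient_module R I\<^esub> y = y \<oplus>\<^bsub>quotient_module R I\<^esub> x"
        using Q.a_comm[unfolded car add] by simp
    qed (simp_all add: Qadd)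
  next
    fix r s x y
    assume "r \<in> carrier R" "s \<in> carrier R"
      and "x \<in> carrier (quotient_module R I)" "y \<in> carrier (quotient_module R I)"
    note 1 = cl[OF this(1)] cl[OF this(2)] this(3,4)[unfolded quotient_module_simps]
    note 2 = \<open>r \<in> carrier R\<close> \<open>s \<in> carrier R\<close>
    show "r \<odot>\<^bsub>quotient_module R I\<^esub> x \<in> carrier (quotient_module R I)"
      using Q.m_closed[unfolded car] 1 by simp
    show "(r \<oplus>\<^bsub>R\<^esub> s) \<odot>\<^bsub>quotient_module R I\<^esub> x =
        r \<odot>\<^bsub>quotient_module R I\<^esub> x \<oplus>\<^bsub>quotient_module R I\<^esub> s \<odot>\<^bsub>quotient_module R I\<^esub> x"
      using Q.l_distr[unfolded car add] 1 by (simp add: hadd 2)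
    show "r \<odot>\<^bsub>quotient_module R I\<^esub> (x \<oplus>\<^bsub>quotient_module R I\<^esub> y) =
        r \<odot>\<^bsub>quotient_module R I\<^esub> x \<oplus>\<^bsub>quotient_module R I\<^esub> r \<odot>\<^bsub>quotient_module R I\<^esub> y"
      using Q.r_distr[unfolded car add] 1 by simp
    show "(r \<otimes>\<^bsub>R\<^esub> s) \<odot>\<^bsub>quotient_module R I\<^esub> x =
        r \<odot>\<^bsub>quotient_module R I\<^esub> (s \<odot>\<^bsub>quotient_module R I\<^esub> x)"
      using Q.m_assoc[unfolded car] 1 by (simp add: hmult 2)
  next
    fix x assume "x \<in> carrier (quotient_module R I)"
    then show "\<one>\<^bsub>R\<^esub> \<odot>\<^bsub>quotient_module R I\<^esub> x = x"
      using Q.l_one[unfolded car] by (simp add: hone)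
  qed (rule is_cring)
qed

lemma tensor_relators_subset:
  fixes M :: "('r, 'm, 'u) module_scheme" and N :: "('r, 'n, 'v) module_scheme"
  assumes "module R M" "module R N"
  shows "tensor_relators R M N \<subseteq> carrier (free_Abelian_group (carrier M \<times> carrier N))"
proof -
  interpret M: module R M by fact
  interpret N: module R N by fact
  have 1: "Poly_Mapping.keys (frag_of p - frag_of q) \<subseteq> S" if "p \<in> S" "q \<in> S"
    for p q :: "'m \<times> 'n" and S
    using keys_diff[of "frag_of p" "frag_of q"] that by auto
  have 2: "Poly_Mapping.keys (frag_of p - frag_of q - frag_of r) \<subseteq> S" if "p \<in> S" "q \<in> S" "r \<in> S"
    for p q r :: "'m \<times> 'n" and S
    using keys_diff[of "frag_of p - frag_of q" "frag_of r"] 1[OF that(1,2)] that by auto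
  show ?thesis
    unfolding tensor_relators_def
    by (intro Un_least; rule subsetI; clarify;
        unfold carrier_free_Abelian_group_iff; (rule 2 | rule 1); simp)
qed

lemma tensor_kernel_subgroup:
  assumes "module R M" "module R N"
  shows "subgroup (tensor_kernel R M N) (free_Abelian_group (carrier M \<times> carrier N))"
  unfolding tensor_kernel_def
  by (intro group.generate_is_subgroup tensor_relators_subset assms) simp

lemma frag_extend_tensor_kernel:
  assumes M: "module R M" and N: "module R N" and N': "module R N'"
    and f: "f \<in> module_hom R N N'"
    and c: "c \<in> tensor_kernel R N M"
  shows "frag_extend (\<lambda>(x, y). frag_of (f x, y)) c \<in> tensor_kernel R N' M"
proof -
  let ?G = "free_Abelian_group (carrier N \<times> carrier M)"
  let ?G' = "free_Abelian_group (carrier N' \<times> carrier M)"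
  let ?F = "frag_extend (\<lambda>(x, y). frag_of (f x, y))"
  have rel: "?F h \<in> tensor_relators R N' M" if "h \<in> tensor_relators R N M" for h
  proof -
    have f1: "f x \<in> carrier N'" if "x \<in> carrier N" for x
      using f that by (auto simp: module_hom_def)
    have f2: "f (x \<oplus>\<^bsub>N\<^esub> y) = f x \<oplus>\<^bsub>N'\<^esub> f y" if "x \<in> carrier N" "y \<in> carrier N" for x y
      using f that by (auto simp: module_hom_def)
    have f3: "f (r \<odot>\<^bsub>N\<^esub> x) = r \<odot>\<^bsub>N'\<^esub> f x" if "r \<in> carrier R" "x \<in> carrier N" for r x
      using f that by (auto simp: module_hom_def)
    from that consider
      (1) x x' y where "h = frag_of (x \<oplus>\<^bsub>N\<^esub> x', y) - frag_of (x, y) - frag_of (x', y)"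
          "x \<in> carrier N" "x' \<in> carrier N" "y \<in> carrier M"
      | (2) x y y' where "h = frag_of (x, y \<oplus>\<^bsub>M\<^esub> y') - frag_of (x, y) - frag_of (x, y')"
          "x \<in> carrier N" "y \<in> carrier M" "y' \<in> carrier M"
      | (3) r x y where "h = frag_of (r \<odot>\<^bsub>N\<^esub> x, y) - frag_of (x, r \<odot>\<^bsub>M\<^esub> y)"
          "r \<in> carrier R" "x \<in> carrier N" "y \<in> carrier M"
      unfolding tensor_relators_def by blast
    then show ?thesis
    proof cases
      case 1
      then show ?thesis
        unfolding tensor_relators_def by (simp add: frag_extend_diff f2) (use f1 in blast)
    next
      case 2
      then show ?thesis
        unfolding tensor_relators_def by (simp add: frag_extend_diff) (use f1 in blast)
    next
      case 3
      then show ?thesis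
        unfolding tensor_relators_def by (simp add: frag_extend_diff f3) (use f1 in blast)
    qed
  qed
  have sub: "h \<in> carrier ?G" if "h \<in> tensor_relators R N M" for h
    using tensor_relators_subset[OF N M] that by blast
  have sub': "h \<in> carrier ?G'" if "h \<in> tensor_relators R N' M" for h
    using tensor_relators_subset[OF N' M] that by blast
  show ?thesis
    using c unfolding tensor_kernel_def
  proof (induction rule: generate.induct)
    case one
    show ?case using generate.one[of ?G'] by simp
  next
    case (incl h)
    then show ?case by (intro generate.incl rel)
  next
    case (inv h)
    then show ?case
      using generate.inv[OF rel, of h ?G'] sub[of h] sub'[OF rel, of h]
      by (simp add: frag_extend_minus)
  next
    case (eng h1 h2)
    then show ?case
      using generate.eng[OF eng.IH] by (simp add: frag_extend_add)
  qed
qed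

lemma tensor_map_rcoset:
  assumes M: "module R M" and N: "module R N" and N': "module R N'"
    and f: "f \<in> module_hom R N N'"
    and c: "c \<in> carrier (free_Abelian_group (carrier N \<times> carrier M))"
  shows "tensor_map R N' M f
      (tensor_kernel R N M #>\<^bsub>free_Abelian_group (carrier N \<times> carrier M)\<^esub> c) =
    tensor_kernel R N' M #>\<^bsub>free_Abelian_group (carrier N' \<times> carrier M)\<^esub>
      frag_extend (\<lambda>(x, y). frag_of (f x, y)) c"
proof -
  let ?G = "free_Abelian_group (carrier N \<times> carrier M)"
  let ?G' = "free_Abelian_group (carrier N' \<times> carrier M)"
  let ?F = "frag_extend (\<lambda>(x, y). frag_of (f x, y))"
  let ?K = "tensor_kernel R N M" and ?K' = "tensor_kernel R N' M"
  interpret K: subgroup ?K ?G by (rule tensor_kernel_subgroup[OF N M])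
  interpret K': subgroup ?K' ?G' by (rule tensor_kernel_subgroup[OF N' M])
  have "f x \<in> carrier N'" if "x \<in> carrier N" for x
    using f that by (auto simp: module_hom_def)
  then have "?F c \<in> carrier ?G'"
    using c keys_frag_extend[of "\<lambda>(x, y). frag_of (f x, y)" c] by fastforce
  then have eq: "?K' #>\<^bsub>?G'\<^esub> ?F (k + c) = ?K' #>\<^bsub>?G'\<^esub> ?F c" if "k \<in> ?K" for k
    using frag_extend_tensor_kernel[OF M N N' f that] K'.mem_carrier
      group.coset_join2[OF group_free_Abelian_group _ K'.subgroup_axioms, of "?F k"]
      group.coset_mult_assoc[OF group_free_Abelian_group K'.subset, of "?F k" "?F c"]
    by (simp add: frag_extend_add)
  have "?K \<noteq> {}" using K.one_closed by blast
  moreover have "?K #>\<^bsub>?G\<^esub> c = (\<lambda>k. k + c) ` ?K" by (auto simp: r_coset_def)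
  ultimately have "(\<lambda>d. ?K' #>\<^bsub>?G'\<^esub> ?F d) ` (?K #>\<^bsub>?G\<^esub> c) = {?K' #>\<^bsub>?G'\<^esub> ?F c}"
    using eq by auto
  then show ?thesis by (simp add: tensor_map_def)
qed

end

(* Tensoring the inclusion of an ideal J into R with the flat module R/I shows that the intersection
   of J and I is contained in the product J I. For J = xR with x in I this yields x = x b for some
   b in I. If a^n lies in I, write a^n = a^n b with b in I. Then a^n (1 - b) = 0, so a (1 - b) is
   nilpotent, hence zero, and a = a b lies in I. *)

theory Submission
  imports Defs
begin

text \<open>The elements keep the type of the ring, so an ideal \<open>J\<close> and the ring itself
  (the case \<open>J = carrier R\<close>) both qualify as test modules in
  \<open>flat_module TYPE('a)\<close>.\<close>

definition ideal_module :: "('r, 'k) ring_scheme \<Rightarrow> 'r set \<Rightarrow> ('r, 'r) module" where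
  "ideal_module R J =
     \<lparr>carrier = J, monoid.mult = monoid.mult R, monoid.one = monoid.one R,
      ring.zero = ring.zero R, ring.add = ring.add R, smult = monoid.mult R\<rparr>"

lemma ideal_module_simps [simp]:
  "carrier (ideal_module R J) = J"
  "x \<oplus>\<^bsub>ideal_module R J\<^esub> y = x \<oplus>\<^bsub>R\<^esub> y"
  "\<zero>\<^bsub>ideal_module R J\<^esub> = \<zero>\<^bsub>R\<^esub>"
  "r \<odot>\<^bsub>ideal_module R J\<^esub> x = r \<otimes>\<^bsub>R\<^esub> x"
  by (simp_all add: ideal_module_def)

lemma module_ideal_module:
  assumes "cring R" "ideal J R"
  shows "module R (ideal_module R J)"
proof -
  interpret cring R by fact
  interpret J: ideal J R by fact
  show ?thesis
  proof (rule moduleI)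
    show "abelian_group (ideal_module R J)"
    proof (rule abelian_groupI)
      fix x assume "x \<in> carrier (ideal_module R J)"
      then show "\<exists>y\<in>carrier (ideal_module R J). y \<oplus>\<^bsub>ideal_module R J\<^esub> x = \<zero>\<^bsub>ideal_module R J\<^esub>"
        using J.a_inv_closed by (auto intro!: bexI[of _ "\<ominus>\<^bsub>R\<^esub> x"] simp: l_neg J.Icarr)
    qed (auto simp: J.Icarr a_ac)
  qed (auto simp: J.Icarr J.I_l_closed l_distr r_distr m_assoc is_cring)
qed

text \<open>The pairing of \<open>n\<close> in \<open>J\<close> and \<open>I +> a\<close> with the
  class of \<open>n \<otimes> a\<close> in R/JI is biadditive and balanced. Its additive extension
  to the free abelian group therefore kills every relator, and so all of
  \<open>tensor_kernel\<close>; at the generator \<open>(x, I +> a)\<close> this says that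
  \<open>x \<otimes> a\<close> vanishes modulo JI.\<close>

lemma frag_of_mem_tensor_kernel:
  fixes R (structure)
  assumes "cring R" and J: "ideal J R" and I: "ideal I R"
    and x: "x \<in> J" and a: "a \<in> carrier R"
    and xa: "frag_of (x, I +> a) \<in> tensor_kernel R (ideal_module R J) (quotient_module R I)"
  shows "x \<otimes> a \<in> ideal_prod R J I"
proof -
  interpret cring R by fact
  interpret J: ideal J R by fact
  interpret I: ideal I R by fact
  define K where "K = ideal_prod R J I"
  have "ideal K R" unfolding K_def by (rule ideal_prod_is_ideal[OF J I])
  then interpret K: ideal K R .
  interpret Q: ring "R Quot K" by (rule K.quotient_is_ring)
  let ?F = "free_Abelian_group (J \<times> a_rcosets I)"
  interpret F: group ?F by simp
  note K_closed = ring_hom_closed[OF K.rcos_ring_hom]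
  note K_add = ring_hom_add[OF K.rcos_ring_hom]
  have coset: "\<exists>a \<in> carrier R. C = I +> a" if "C \<in> a_rcosets I" for C
    using that by (auto simp: A_RCOSETS_def')
  have cl: "I +> a \<in> a_rcosets I" if "a \<in> carrier R" for a
    using that by (simp add: a_rcosetsI I.a_subset)
  \<comment> \<open>\<open>f\<close> induces the additive map from \<open>J \<otimes> R/I\<close> to \<open>R/JI\<close> sending \<open>n \<otimes> (I + a)\<close> to \<open>JI + n a\<close>.\<close>
  define f where "f = (\<lambda>(n, C). K +> (n \<otimes> (SOME a. a \<in> carrier R \<and> C = I +> a)))"
  \<comment> \<open>Independence of the chosen representative: two representatives of a coset differ
    by an element of \<open>I\<close>, and multiplying that by \<open>n\<close> in \<open>J\<close>
    lands in \<open>K\<close>.\<close>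
  have f: "f (n, I +> a) = K +> (n \<otimes> a)" if n: "n \<in> J" and a: "a \<in> carrier R" for n a
  proof -
    define b where "b = (SOME b. b \<in> carrier R \<and> I +> a = I +> b)"
    have b: "b \<in> carrier R" "I +> a = I +> b"
      using someI[of "\<lambda>b. b \<in> carrier R \<and> I +> a = I +> b" a] a by (simp_all add: b_def)
    have nR: "n \<in> carrier R" using n by (rule J.Icarr)
    have "b \<ominus> a \<in> I"
      using quotient_eq_iff_same_a_r_cos[OF I b(1) a] b(2) by simp
    then have "n \<otimes> (b \<ominus> a) \<in> K" unfolding K_def by (rule ideal_prod.prod[OF n])
    moreover have "n \<otimes> (b \<ominus> a) = n \<otimes> b \<ominus> n \<otimes> a"
      using nR a b(1) by (simp add: minus_eq r_distr r_minus)
    ultimately have "K +> (n \<otimes> b) = K +> (n \<otimes> a)"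
      using quotient_eq_iff_same_a_r_cos[OF \<open>ideal K R\<close>, of "n \<otimes> b" "n \<otimes> a"] nR a b(1) by simp
    then show ?thesis by (simp add: f_def b_def)
  qed
  have "f p \<in> carrier (add_monoid (R Quot K))" if p: "p \<in> J \<times> a_rcosets I" for p
  proof -
    obtain n C where "p = (n, C)" "n \<in> J" "C \<in> a_rcosets I"
      using p by blast
    moreover from this(3) obtain a where "a \<in> carrier R" "C = I +> a"
      using coset by blast
    ultimately have "p = (n, I +> a)" "n \<in> J" "a \<in> carrier R" by simp_all
    then show ?thesis using K_closed J.Icarr by (simp add: f)
  qed
  then have "f ` (J \<times> a_rcosets I) \<subseteq> carrier (add_monoid (R Quot K))"
    by (rule image_subsetI)
  \<comment> \<open>The universal property of the free abelian group, with the additive group of R/K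
    as target, extends \<open>f\<close> from generators to \<open>h\<close>.\<close>
  then obtain h where h: "h \<in> hom ?F (add_monoid (R Quot K))"
    and h_frag: "\<And>p. p \<in> J \<times> a_rcosets I \<Longrightarrow> h (frag_of p) = f p"
    by (rule comm_group.free_Abelian_group_universal[OF Q.a_comm_group]) (rule that)
  have h_hom: "group_hom ?F (add_monoid (R Quot K)) h"
    by (intro group_hom.intro group_hom_axioms.intro Q.a_group h F.group_axioms)
  have h_rel: "h (frag_of (n, I +> a)) = K +> (n \<otimes> a)" if "n \<in> J" "a \<in> carrier R" for n a
    using that by (simp add: h_frag f cl)
  \<comment> \<open>Relators are written with \<open>-\<close>, which in \<open>?F\<close> is
    multiplication by an inverse; the homomorphism law is restated in that form.\<close>
  have h_diff: "h (c - d) = h c \<ominus>\<^bsub>R Quot K\<^esub> h d" if "c \<in> carrier ?F" "d \<in> carrier ?F" for c d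
    using hom_mult[OF h that(1) F.inv_closed[OF that(2)]] group_hom.hom_inv[OF h_hom that(2)] that(2)
    by (simp add: a_minus_def a_inv_def)
  have mem: "frag_of (n, I +> a) \<in> carrier ?F" if "n \<in> J" "a \<in> carrier R" for n a
    using that by (simp add: cl)
  have mem2: "c - d \<in> carrier ?F" if "c \<in> carrier ?F" "d \<in> carrier ?F" for c d
    using F.m_closed[OF that(1) F.inv_closed[OF that(2)]] that(2) by simp
  \<comment> \<open>This is the shape that \<open>h\<close> gives to both kinds of additivity
    relators.\<close>
  have add_diff: "(p \<oplus>\<^bsub>R Quot K\<^esub> q) \<ominus>\<^bsub>R Quot K\<^esub> p \<ominus>\<^bsub>R Quot K\<^esub> q = \<zero>\<^bsub>R Quot K\<^esub>"
    if "p \<in> carrier (R Quot K)" "q \<in> carrier (R Quot K)" for p q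
    using Q.r_neg[of "p \<oplus>\<^bsub>R Quot K\<^esub> q"] that by (simp add: Q.minus_eq Q.minus_add Q.a_assoc)
  have kernel_mem: "u \<in> kernel ?F (add_monoid (R Quot K)) h \<longleftrightarrow>
      u \<in> carrier ?F \<and> h u = \<zero>\<^bsub>R Quot K\<^esub>" for u
    by (simp add: kernel_def)
  note diff = h_diff mem mem2 h_rel
  have add: "(I +> a) <+> (I +> b) = I +> (a \<oplus> b)" if "a \<in> carrier R" "b \<in> carrier R" for a b
    using ring_hom_add[OF I.rcos_ring_hom that] by (simp add: FactRing_def)
  have mult: "(I +> a) \<otimes>\<^bsub>R Quot I\<^esub> (I +> b) = I +> (a \<otimes> b)"
    if "a \<in> carrier R" "b \<in> carrier R" for a b
    using ring_hom_mult[OF I.rcos_ring_hom that] by simp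
  have "tensor_relators R (ideal_module R J) (quotient_module R I)
    \<subseteq> kernel ?F (add_monoid (R Quot K)) h"
  proof
    fix u assume "u \<in> tensor_relators R (ideal_module R J) (quotient_module R I)"
    \<comment> \<open>Every coset gets an explicit representative, also for sums and scalar
      multiples, so that \<open>h_rel\<close> can evaluate \<open>h\<close> on each
      generator.\<close>
    from this[unfolded tensor_relators_def] consider
      (1) n n' a where "u = frag_of (n \<oplus> n', I +> a) - frag_of (n, I +> a) - frag_of (n', I +> a)"
          "n \<in> J" "n' \<in> J" "a \<in> carrier R"
      | (2) n a b where "u = frag_of (n, I +> (a \<oplus> b)) - frag_of (n, I +> a) - frag_of (n, I +> b)"
          "n \<in> J" "a \<in> carrier R" "b \<in> carrier R"
      | (3) r n a where "u = frag_of (r \<otimes> n, I +> a) - frag_of (n, I +> (r \<otimes> a))"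
          "r \<in> carrier R" "n \<in> J" "a \<in> carrier R"
    proof (elim UnE CollectE exE conjE)
      fix n n' C assume "u = frag_of (n \<oplus>\<^bsub>ideal_module R J\<^esub> n', C) - frag_of (n, C) - frag_of (n', C)"
        "n \<in> carrier (ideal_module R J)" "n' \<in> carrier (ideal_module R J)"
        "C \<in> carrier (quotient_module R I)"
      with coset show ?thesis by (metis 1 ideal_module_simps(1,2) quotient_module_simps(1))
    next
      fix n C D
      assume "u = frag_of (n, C \<oplus>\<^bsub>quotient_module R I\<^esub> D) - frag_of (n, C) - frag_of (n, D)"
        "n \<in> carrier (ideal_module R J)"
        "C \<in> carrier (quotient_module R I)" "D \<in> carrier (quotient_module R I)"
      with coset add show ?thesis
        by (metis 2 ideal_module_simps(1) quotient_module_simps(1,2))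
    next
      fix r n C
      assume "u = frag_of (r \<odot>\<^bsub>ideal_module R J\<^esub> n, C) - frag_of (n, r \<odot>\<^bsub>quotient_module R I\<^esub> C)"
        "r \<in> carrier R" "n \<in> carrier (ideal_module R J)" "C \<in> carrier (quotient_module R I)"
      with coset mult show ?thesis
        by (metis 3 ideal_module_simps(1,4) quotient_module_simps(1,4))
    qed
    then show "u \<in> kernel ?F (add_monoid (R Quot K)) h"
    proof cases
      case 1
      have "n \<in> carrier R" "n' \<in> carrier R" using 1 J.Icarr by auto
      with 1 have "h u = \<zero>\<^bsub>R Quot K\<^esub>"
        by (simp only: diff J.a_closed l_distr K_add K_closed m_closed add_diff)
      with 1 show ?thesis
        by (simp only: kernel_mem diff J.a_closed)
    next
      case 2
      have "n \<in> carrier R" using 2 J.Icarr by auto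
      with 2 have "h u = \<zero>\<^bsub>R Quot K\<^esub>"
        by (simp only: diff a_closed r_distr K_add K_closed m_closed add_diff)
      with 2 show ?thesis
        by (simp only: kernel_mem diff a_closed)
    next
      case 3
      have n: "n \<in> carrier R" using 3 J.Icarr by auto
      then have "(r \<otimes> n) \<otimes> a = n \<otimes> (r \<otimes> a)" using 3 by (simp add: m_ac)
      with 3 n have "h u = \<zero>\<^bsub>R Quot K\<^esub>"
        by (simp only: diff J.I_l_closed m_closed K_closed Q.r_neg Q.minus_eq)
      with 3 show ?thesis
        by (simp only: kernel_mem diff J.I_l_closed m_closed)
    qed
  qed
  then have "tensor_kernel R (ideal_module R J) (quotient_module R I)
    \<subseteq> kernel ?F (add_monoid (R Quot K)) h"
    unfolding tensor_kernel_def
    using F.generate_subgroup_incl[OF _ group_hom.subgroup_kernel[OF h_hom]] by simp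
  with xa have "h (frag_of (x, I +> a)) = \<one>\<^bsub>add_monoid (R Quot K)\<^esub>"
    unfolding kernel_def by blast
  \<comment> \<open>The neutral element of the additive group of R/K is the coset \<open>K\<close>
    itself.\<close>
  then have "K +> (x \<otimes> a) = K"
    unfolding h_rel[OF x a] by (simp only: FactRing_def monoid.simps ring.simps partial_object.simps)
  moreover have "x \<otimes> a \<in> carrier R" using J.Icarr[OF x] a by (rule m_closed)
  ultimately show ?thesis
    using K.rcos_const_imp_mem unfolding K_def by blast
qed

text \<open>For \<open>x\<close> in both ideals, x tensor 1 in the tensor product of
  \<open>J\<close> with R/I becomes 1 tensor x = 1 tensor 0 = 0 once \<open>J\<close> is enlarged to
  \<open>R\<close>. By flatness it is already zero over \<open>J\<close>, and
  \<open>frag_of_mem_tensor_kernel\<close> with \<open>a\<close> = 1 puts \<open>x\<close> into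
  JI.\<close>

lemma flat_quotient_inter_subset_prod:
  fixes R :: "('a, 'b) ring_scheme"
  assumes "cring R" and J: "ideal J R" and I: "ideal I R"
    and flat: "flat_module TYPE('a) R (quotient_module R I)"
  shows "J \<inter> I \<subseteq> ideal_prod R J I"
proof
  fix x assume x: "x \<in> J \<inter> I"
  interpret cring R by fact
  interpret J: ideal J R by fact
  interpret I: ideal I R by fact
  let ?M = "quotient_module R I" and ?N = "ideal_module R J" and ?N' = "ideal_module R (carrier R)"
  let ?G = "free_Abelian_group (carrier ?N \<times> carrier ?M)"
  let ?G' = "free_Abelian_group (carrier ?N' \<times> carrier ?M)"
  let ?K = "tensor_kernel R ?N ?M" and ?K' = "tensor_kernel R ?N' ?M"
  have M: "module R ?M" using \<open>cring R\<close> I by (rule module_quotient_module)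
  have N: "module R ?N" using \<open>cring R\<close> J by (rule module_ideal_module)
  have N': "module R ?N'" using \<open>cring R\<close> oneideal by (rule module_ideal_module)
  \<comment> \<open>The inclusion of \<open>J\<close> into \<open>R\<close>; it is \<open>id\<close>
    because both modules have the same element type.\<close>
  have id: "id \<in> module_hom R ?N ?N'" by (auto simp: module_hom_def J.Icarr)
  interpret G: group ?G by simp
  interpret G': group ?G' by simp
  interpret K: subgroup ?K ?G by (rule tensor_kernel_subgroup[OF N M])
  interpret K': subgroup ?K' ?G' by (rule tensor_kernel_subgroup[OF N' M])
  have xR: "x \<in> carrier R" using x J.Icarr by blast
  have cl: "I +>\<^bsub>R\<^esub> a \<in> a_rcosets\<^bsub>R\<^esub> I" if "a \<in> carrier R" for a
    using that by (simp add: a_rcosetsI I.a_subset)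
  \<comment> \<open>The same formal generator represents x tensor 1 over \<open>J\<close> (in
    \<open>?G\<close>) and over \<open>R\<close> (in \<open>?G'\<close>).\<close>
  let ?c = "frag_of (x, I +>\<^bsub>R\<^esub> \<one>\<^bsub>R\<^esub>)"
  have c: "?c \<in> carrier ?G" using x cl[OF one_closed] by simp
  have Ix: "I +>\<^bsub>R\<^esub> x = I" using x a_rcos_zero[OF I] by blast
  have I0: "I \<in> a_rcosets\<^bsub>R\<^esub> I" using cl[OF xR] Ix by simp
  have "?c \<in> ?K'"
  proof -
    have II: "I <+>\<^bsub>R\<^esub> I = I"
      using abelian_monoid.l_zero[OF module.axioms(2)[OF M, THEN abelian_group.axioms(1)], of I] I0 by simp
    have "x \<odot>\<^bsub>?M\<^esub> (I +>\<^bsub>R\<^esub> \<one>\<^bsub>R\<^esub>) = I"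
      using ring_hom_mult[OF I.rcos_ring_hom xR one_closed] xR Ix by simp
    \<comment> \<open>The balancing relator with scalar \<open>x\<close> and first entry 1 moves
      \<open>x\<close> across the tensor sign. Its first entry lies in \<open>R\<close> but in
      general not in \<open>J\<close>.\<close>
    then have "frag_of (x, I +>\<^bsub>R\<^esub> \<one>\<^bsub>R\<^esub>) - frag_of (\<one>\<^bsub>R\<^esub>, I) \<in> tensor_relators R ?N' ?M"
      unfolding tensor_relators_def using xR cl[OF one_closed]
      by (intro UnI2 CollectI exI[of _ x] exI[of _ "\<one>\<^bsub>R\<^esub>"] exI[of _ "I +>\<^bsub>R\<^esub> \<one>\<^bsub>R\<^esub>"]) simp
    then have 1: "?c - frag_of (\<one>\<^bsub>R\<^esub>, I) \<in> ?K'"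
      unfolding tensor_kernel_def by (rule generate.incl)
    \<comment> \<open>The relator for \<open>1 \<otimes> (0 + 0) = 1 \<otimes> 0 + 1 \<otimes> 0\<close>.\<close>
    have "- frag_of (\<one>\<^bsub>R\<^esub>, I) \<in> tensor_relators R ?N' ?M"
      unfolding tensor_relators_def using I0 II
      by (intro UnI1 UnI2 CollectI exI[of _ "\<one>\<^bsub>R\<^esub>"] exI[of _ I]) simp
    then have 2: "- frag_of (\<one>\<^bsub>R\<^esub>, I) \<in> ?K'"
      unfolding tensor_kernel_def by (rule generate.incl)
    have "frag_of (\<one>\<^bsub>R\<^esub>, I) \<in> ?K'"
      using K'.m_inv_closed[OF 2] I0 by simp
    from K'.m_closed[OF 1 this] show ?thesis by simp
  qed
  then have "?K' #>\<^bsub>?G'\<^esub> ?c = ?K' #>\<^bsub>?G'\<^esub> \<one>\<^bsub>?G'\<^esub>"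
    using G'.coset_join2[OF _ K'.subgroup_axioms] K'.mem_carrier K'.one_closed by metis
  \<comment> \<open>On representatives the induced map is the linear extension of the identity on
    generators, which fixes both \<open>?c\<close> and the neutral element.\<close>
  then have "tensor_map R ?N' ?M id (?K #>\<^bsub>?G\<^esub> ?c) = tensor_map R ?N' ?M id (?K #>\<^bsub>?G\<^esub> \<one>\<^bsub>?G\<^esub>)"
    using tensor_map_rcoset[OF M N N' id c] tensor_map_rcoset[OF M N N' id G.one_closed] by simp
  moreover have "inj_on (tensor_map R ?N' ?M id) (carrier (tensor_product R ?N ?M))"
    using flat N N' id unfolding flat_module_def by (metis inj_on_id)
  moreover have "?K #>\<^bsub>?G\<^esub> d \<in> carrier (tensor_product R ?N ?M)" if "d \<in> carrier ?G" for d
    using that by (auto simp: tensor_product_def FactGroup_def RCOSETS_def)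
  ultimately have "?K #>\<^bsub>?G\<^esub> ?c = ?K #>\<^bsub>?G\<^esub> \<one>\<^bsub>?G\<^esub>"
    using c G.one_closed by (blast dest: inj_onD)
  then have "?c \<in> ?K"
    using G.coset_join1[OF _ c K.subgroup_axioms] G.coset_mult_one[OF K.subset] by simp
  from frag_of_mem_tensor_kernel[OF \<open>cring R\<close> J I _ one_closed this] x xR
  show "x \<in> ideal_prod R J I" by simp
qed

text \<open>The inclusion of the intersection in the product is applied to \<open>J\<close> = xR,
  which contains \<open>x\<close>. Since (r x) j = x (r j), and sums of multiples of
  \<open>x\<close> by elements of \<open>I\<close> are again of this form, the product of xR and
  \<open>I\<close> lies in xI.\<close>

lemma flat_quotient_obtains_mult:
  fixes R :: "('a, 'b) ring_scheme"
  assumes "cring R" and I: "ideal I R"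
    and flat: "flat_module TYPE('a) R (quotient_module R I)" and x: "x \<in> I"
  obtains b where "b \<in> I" "x = x \<otimes>\<^bsub>R\<^esub> b"
proof -
  interpret cring R by fact
  interpret I: ideal I R by fact
  have xR: "x \<in> carrier R" using x by (rule I.Icarr)
  have "s \<in> (\<lambda>b. x \<otimes>\<^bsub>R\<^esub> b) ` I" if "s \<in> ideal_prod R (PIdl\<^bsub>R\<^esub> x) I" for s
    using that
  proof induction
    case (prod i j)
    then obtain r where "r \<in> carrier R" "i = r \<otimes>\<^bsub>R\<^esub> x" by (auto simp: cgenideal_def)
    with prod xR show ?case
      by (intro image_eqI[of _ _ "r \<otimes>\<^bsub>R\<^esub> j"]) (auto simp: I.I_l_closed I.Icarr m_assoc m_lcomm)
  next
    case (sum s t)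
    then obtain b c where "b \<in> I" "c \<in> I" "s = x \<otimes>\<^bsub>R\<^esub> b" "t = x \<otimes>\<^bsub>R\<^esub> c" by blast
    with xR show ?case
      by (intro image_eqI[of _ _ "b \<oplus>\<^bsub>R\<^esub> c"]) (auto simp: I.Icarr r_distr)
  qed
  moreover have "x \<in> ideal_prod R (PIdl\<^bsub>R\<^esub> x) I"
    using flat_quotient_inter_subset_prod[OF \<open>cring R\<close> cgenideal_ideal[OF xR] I flat]
      cgenideal_self[OF xR] x by blast
  ultimately show thesis using that by blast
qed

theorem corollary3p5:
  fixes R :: "('a, 'b) ring_scheme" and I :: "'a set"
  assumes "cring R"
    and "reduced_ring R"
    and "ideal I R"
    and "flat_module TYPE('a) R (quotient_module R I)"
  shows "I = ideal_radical R I"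
proof
  interpret cring R by fact
  interpret I: ideal I R by fact
  show "I \<subseteq> ideal_radical R I"
  proof
    fix x assume x: "x \<in> I"
    \<comment> \<open>Exponent 1 is the smallest that \<open>ideal_radical\<close> admits.\<close>
    then have "x [^]\<^bsub>R\<^esub> (1::nat) \<in> I" by (simp add: I.Icarr)
    with x show "x \<in> ideal_radical R I" unfolding ideal_radical_def using I.Icarr by blast
  qed
  show "ideal_radical R I \<subseteq> I"
  proof
    fix a assume "a \<in> ideal_radical R I"
    then obtain n :: nat where a: "a \<in> carrier R" and n: "n \<ge> 1" and an: "a [^]\<^bsub>R\<^esub> n \<in> I"
      unfolding ideal_radical_def by blast
    obtain b where b: "b \<in> I" and eq: "a [^]\<^bsub>R\<^esub> n = a [^]\<^bsub>R\<^esub> n \<otimes>\<^bsub>R\<^esub> b"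
      using flat_quotient_obtains_mult[OF assms(1,3,4) an] .
    have bR: "b \<in> carrier R" using b by (rule I.Icarr)
    let ?d = "\<one>\<^bsub>R\<^esub> \<ominus>\<^bsub>R\<^esub> b"
    have d: "?d \<in> carrier R" using bR by simp
    have dist: "y \<otimes>\<^bsub>R\<^esub> ?d = y \<ominus>\<^bsub>R\<^esub> y \<otimes>\<^bsub>R\<^esub> b" if "y \<in> carrier R" for y
      using that bR by (simp add: minus_eq r_distr r_minus)
    have zero: "a [^]\<^bsub>R\<^esub> n \<otimes>\<^bsub>R\<^esub> ?d = \<zero>\<^bsub>R\<^esub>"
      using dist[of "a [^]\<^bsub>R\<^esub> n"] a by (simp add: r_neg minus_eq del: r_distr flip: eq)
    \<comment> \<open>As \<open>n\<close> is positive, one factor \<open>?d\<close> can be split off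
      the power of \<open>?d\<close> and paired with the power of \<open>a\<close>, so that
      \<open>zero\<close> applies.\<close>
    obtain m where m: "n = Suc m" using n by (metis Suc_le_D One_nat_def)
    have "(a \<otimes>\<^bsub>R\<^esub> ?d) [^]\<^bsub>R\<^esub> n = a [^]\<^bsub>R\<^esub> n \<otimes>\<^bsub>R\<^esub> ?d \<otimes>\<^bsub>R\<^esub> ?d [^]\<^bsub>R\<^esub> m"
      using a d by (simp add: nat_pow_distrib m m_ac)
    also have "\<dots> = \<zero>\<^bsub>R\<^esub>" using zero d by simp
    finally have "a \<otimes>\<^bsub>R\<^esub> ?d = \<zero>\<^bsub>R\<^esub>"
      using \<open>reduced_ring R\<close> a d unfolding reduced_ring_def by blast
    then have "a = a \<otimes>\<^bsub>R\<^esub> b" using a bR by (simp add: dist)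
    then show "a \<in> I" using I.I_l_closed[OF b a] by simp
  qed
qed

end
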